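(* Let $M$ be an arbitrary (not necessarily abelian) group and let $c\colon G\to M$ be a cellular cover. If the kernel $K=\ker c$ is a free abelian group, then $|K|\le|M|$.
   Context: A group homomorphism $c\colon G\to M$ is called a cellular cover (of $M$) if every group homomorphism $\varphi\colon G\to M$ factors uniquely through $c$, i.e. there is a unique endomorphism $\widetilde\varphi\in\operatorname{End}(G)$ with $c(\widetilde\varphi(g))=\varphi(g)$ for all $g\in G$; equivalently, the map $\operatorname{Hom}(G,G)\to\operatorname{Hom}(G,M)$ induced by $c$ is a bijection. A cellular cover is not required to be surjective. *)

theory Defs
  imports "HOL-Algebra.Free_Abelian_Groups"
begin

(* HOL functions are total, so an endomorphism is only determined on the carrier.
   Restricting to extensional functions makes the uniqueness refer to values on the
   carrier alone; the given homomorphism phi needs no such restriction, because it is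
   only compared on the carrier. *)
definition cellular_cover ::
    "('a, 'm) monoid_scheme \<Rightarrow> ('b, 'n) monoid_scheme \<Rightarrow> ('a \<Rightarrow> 'b) \<Rightarrow> bool"
  where "cellular_cover G M c \<longleftrightarrow>
    group G \<and> group M \<and> c \<in> hom G M \<and>
    (\<forall>\<phi> \<in> hom G M. \<exists>!\<psi>. \<psi> \<in> hom G G \<and> \<psi> \<in> extensional (carrier G) \<and>
       (\<forall>g \<in> carrier G. c (\<psi> g) = \<phi> g))"

(* Taking the index set S over the element type of H loses no generality:
   a basis of H is itself a subset of the carrier. *)
definition is_free_abelian :: "('a, 'm) monoid_scheme \<Rightarrow> bool"
  where "is_free_abelian H \<longleftrightarrow> group H \<and> (\<exists>S :: 'a set. H \<cong> free_Abelian_group S)"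

end

theory Submission
  imports Defs
begin

text \<open>
  Uniqueness of lifts forces the kernel \<open>K\<close> to be central in \<open>G\<close>, and it forces every homomorphism
  \<open>G \<rightarrow> K\<close> to be trivial; so if \<open>K \<noteq> 1\<close> is free abelian on \<open>S\<close>, there is no nonzero homomorphism
  \<open>G \<rightarrow> \<int>\<close>. Choosing coset representatives yields a map \<open>r: G \<rightarrow> \<int>\<^sup>S\<close> with \<open>r (k x) = k + r x\<close> for
  \<open>k \<in> K\<close>. If the image \<open>N\<close> of \<open>c\<close> is finite, averaging a coordinate of \<open>r\<close> over \<open>N\<close> (the transfer)
  gives a nonzero homomorphism \<open>G \<rightarrow> \<int>\<close>. If \<open>N\<close> is infinite, the defect of additivity of \<open>r\<close> takes at
  most \<open>|N|\<close> values, each with finite support; a coordinate outside all these supports would again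
  be a nonzero homomorphism \<open>G \<rightarrow> \<int>\<close>, so \<open>|S| \<le> |N|\<close> and hence \<open>|K| \<le> |N|\<close>.
\<close>

section \<open>Maps equivariant under a central kernel\<close>

lemma (in group_hom) kernel_mult_inv:
  assumes "x \<in> carrier G" "y \<in> carrier G" "h x = h y"
  shows "x \<otimes> inv y \<in> kernel G H h"
  using assms by (simp add: kernel_def)

text \<open>Dividing \<open>x\<close> by the representative \<open>t (h x)\<close> chosen for its
  kernel coset gives an element of the kernel, to which \<open>a\<close> applies. Multiplying
  \<open>x\<close> by \<open>k\<close> leaves the representative unchanged and multiplies the
  quotient by \<open>k\<close>.\<close>

lemma (in group_hom) kernel_equivariant_map:
  fixes a :: "'a \<Rightarrow> 'e::ab_group_add"
  assumes add: "\<And>k l. k \<in> kernel G H h \<Longrightarrow> l \<in> kernel G H h \<Longrightarrow> a (k \<otimes> l) = a k + a l"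
  obtains r where "\<And>k x. k \<in> kernel G H h \<Longrightarrow> x \<in> carrier G \<Longrightarrow> r (k \<otimes> x) = a k + r x"
proof
  define t where "t = inv_into (carrier G) h"
  fix k x assume k: "k \<in> kernel G H h" and x: "x \<in> carrier G"
  have t: "t (h x) \<in> carrier G" "h (t (h x)) = h x"
    using x by (auto simp: t_def inv_into_into f_inv_into_f)
  have kc: "k \<in> carrier G" "h k = \<one>\<^bsub>H\<^esub>"
    using k by (auto simp: kernel_def)
  have "k \<otimes> x \<otimes> inv t (h (k \<otimes> x)) = k \<otimes> (x \<otimes> inv t (h x))"
    using x kc t by (simp add: G.m_assoc)
  moreover have "x \<otimes> inv t (h x) \<in> kernel G H h"
    using x t by (intro kernel_mult_inv) auto
  ultimately show "a (k \<otimes> x \<otimes> inv t (h (k \<otimes> x))) = a k + a (x \<otimes> inv t (h x))"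
    using k add by simp
qed

text \<open>\<open>T g\<close> sums \<open>r (g \<otimes> x) - r x\<close> over coset
  representatives \<open>x\<close>. As the kernel is central, replacing \<open>x\<close> by
  \<open>k \<otimes> x\<close> adds \<open>a k\<close> to both terms, so the choice of
  representatives is immaterial. For \<open>g\<close> in the kernel every summand is
  \<open>a g\<close>.\<close>

lemma (in group_hom) transfer:
  fixes r :: "'a \<Rightarrow> int"
  assumes fin: "finite (h ` carrier G)"
    and central: "\<And>k x. k \<in> kernel G H h \<Longrightarrow> x \<in> carrier G \<Longrightarrow> k \<otimes> x = x \<otimes> k"
    and r: "\<And>k x. k \<in> kernel G H h \<Longrightarrow> x \<in> carrier G \<Longrightarrow> r (k \<otimes> x) = a k + r x"
  obtains T where "\<And>x y. x \<in> carrier G \<Longrightarrow> y \<in> carrier G \<Longrightarrow> T (x \<otimes> y) = T x + T y"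
    and "\<And>k. k \<in> kernel G H h \<Longrightarrow> T k = int (card (h ` carrier G)) * a k"
proof
  define t where "t = inv_into (carrier G) h"
  define T where "T g = (\<Sum>z \<in> h ` carrier G. r (g \<otimes> t z) - r (t z))" for g
  have t: "t z \<in> carrier G" "h (t z) = z" if "z \<in> h ` carrier G" for z
    using that by (auto simp: t_def inv_into_into f_inv_into_f)
  have coset: "r (g \<otimes> x) - r x = r (g \<otimes> y) - r y"
    if "g \<in> carrier G" "x \<in> carrier G" "y \<in> carrier G" "h x = h y" for g x y
  proof -
    define k where "k = x \<otimes> inv y"
    have k: "k \<in> kernel G H h" "k \<in> carrier G"
      using that kernel_mult_inv by (auto simp: k_def)
    have x: "x = k \<otimes> y"
      using that by (simp add: k_def G.m_assoc)
    have "g \<otimes> x = k \<otimes> (g \<otimes> y)"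
      using that k central[of k g] by (simp add: x flip: G.m_assoc)
    then show ?thesis
      using that k x r by simp
  qed
  show "T (x \<otimes> y) = T x + T y" if x: "x \<in> carrier G" and y: "y \<in> carrier G" for x y
  proof -
    \<comment> \<open>The image of \<open>h\<close> is a subgroup, so left translation by
      \<open>h y\<close> permutes it; this reindexes the sum below.\<close>
    have bij: "bij_betw (\<lambda>z. h y \<otimes>\<^bsub>H\<^esub> z) (h ` carrier G) (h ` carrier G)"
    proof (rule bij_betwI[where g = "\<lambda>z. inv\<^bsub>H\<^esub> (h y) \<otimes>\<^bsub>H\<^esub> z"])
      show "(\<lambda>z. h y \<otimes>\<^bsub>H\<^esub> z) \<in> h ` carrier G \<rightarrow> h ` carrier G"
        using y by (auto simp flip: hom_mult)
      show "(\<lambda>z. inv\<^bsub>H\<^esub> (h y) \<otimes>\<^bsub>H\<^esub> z) \<in> h ` carrier G \<rightarrow> h ` carrier G"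
        using y by (auto simp flip: hom_mult hom_inv)
    qed (use y in \<open>auto simp flip: H.m_assoc\<close>)
    have "T (x \<otimes> y) = (\<Sum>z \<in> h ` carrier G.
        (r (x \<otimes> (y \<otimes> t z)) - r (y \<otimes> t z)) + (r (y \<otimes> t z) - r (t z)))"
      unfolding T_def using x y t by (intro sum.cong) (auto simp: G.m_assoc)
    also have "\<dots> = (\<Sum>z \<in> h ` carrier G. r (x \<otimes> (y \<otimes> t z)) - r (y \<otimes> t z)) + T y"
      unfolding T_def by (rule sum.distrib)
    \<comment> \<open>\<open>y \<otimes> t z\<close> need not be the chosen representative of its
      coset, but by \<open>coset\<close> it may be replaced by that one.\<close>
    also have "(\<Sum>z \<in> h ` carrier G. r (x \<otimes> (y \<otimes> t z)) - r (y \<otimes> t z))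
        = (\<Sum>z \<in> h ` carrier G. r (x \<otimes> t (h y \<otimes>\<^bsub>H\<^esub> z)) - r (t (h y \<otimes>\<^bsub>H\<^esub> z)))"
    proof (rule sum.cong)
      fix z assume z: "z \<in> h ` carrier G"
      have "h y \<otimes>\<^bsub>H\<^esub> z \<in> h ` carrier G"
        using bij z by (auto simp: bij_betw_def)
      then show "r (x \<otimes> (y \<otimes> t z)) - r (y \<otimes> t z)
          = r (x \<otimes> t (h y \<otimes>\<^bsub>H\<^esub> z)) - r (t (h y \<otimes>\<^bsub>H\<^esub> z))"
        using x y z t by (intro coset) auto
    qed simp
    also have "\<dots> = T x"
      unfolding T_def by (rule sum.reindex_bij_betw[OF bij])
    finally show ?thesis .
  qed
  show "T k = int (card (h ` carrier G)) * a k" if "k \<in> kernel G H h" for k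
    using that r t by (simp add: T_def)
qed

section \<open>Homomorphisms into the kernel of a cellular cover\<close>

text \<open>Both maps lift the homomorphism \<open>c \<circ> g\<close>, and lifts are unique.
  Uniqueness holds among extensional functions, so it is applied to the restrictions of
  \<open>f\<close> and \<open>g\<close> to the carrier.\<close>

lemma cellular_cover_endomorphism_eq:
  assumes "cellular_cover G M c" "f \<in> hom G G" "g \<in> hom G G"
    and eq: "\<And>x. x \<in> carrier G \<Longrightarrow> c (f x) = c (g x)"
    and x: "x \<in> carrier G"
  shows "f x = g x"
proof -
  interpret G: group G
    using assms by (simp add: cellular_cover_def)
  have c: "c \<in> hom G M"
    using assms by (simp add: cellular_cover_def)
  have res: "restrict u (carrier G) \<in> hom G G" if "u \<in> hom G G" for u
    using that by (auto simp: hom_def Pi_def)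
  have "(\<lambda>x. c (g x)) \<in> hom G M"
    using c assms(3) by (auto simp: hom_def Pi_def)
  with assms(1) have "\<exists>!u. u \<in> hom G G \<and> u \<in> extensional (carrier G) \<and>
      (\<forall>x \<in> carrier G. c (u x) = c (g x))"
    unfolding cellular_cover_def by (elim conjE) (erule (1) bspec)
  then obtain u where u: "v \<in> hom G G \<and> v \<in> extensional (carrier G) \<and>
      (\<forall>x \<in> carrier G. c (v x) = c (g x)) \<longrightarrow> v = u" for v
    by (elim ex1E) iprover
  have "restrict f (carrier G) = u" "restrict g (carrier G) = u"
    using u res[OF assms(2)] res[OF assms(3)] eq by simp_all
  then have "restrict f (carrier G) = restrict g (carrier G)"
    by simp
  then show ?thesis
    using x by (metis restrict_apply')
qed

text \<open>Conjugation by \<open>k\<close> and the identity agree after composition with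
  \<open>c\<close>, because \<open>c k\<close> is trivial.\<close>

lemma cellular_cover_kernel_central:
  assumes "cellular_cover G M c" and k: "k \<in> kernel G M c" and x: "x \<in> carrier G"
  shows "k \<otimes>\<^bsub>G\<^esub> x = x \<otimes>\<^bsub>G\<^esub> k"
proof -
  interpret group_hom G M c
    using assms by (simp add: cellular_cover_def group_hom_def group_hom_axioms_def)
  have kc: "k \<in> carrier G" "c k = \<one>\<^bsub>M\<^esub>"
    using k by (auto simp: kernel_def)
  have "k \<otimes>\<^bsub>G\<^esub> x \<otimes>\<^bsub>G\<^esub> inv\<^bsub>G\<^esub> k = x"
  proof (rule cellular_cover_endomorphism_eq[OF assms(1) _ _ _ x])
    have "inv\<^bsub>G\<^esub> k \<otimes>\<^bsub>G\<^esub> (k \<otimes>\<^bsub>G\<^esub> z) = z" if "z \<in> carrier G" for z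
      using that kc by (simp flip: G.m_assoc)
    then show "(\<lambda>x. k \<otimes>\<^bsub>G\<^esub> x \<otimes>\<^bsub>G\<^esub> inv\<^bsub>G\<^esub> k) \<in> hom G G"
      using kc by (intro homI) (auto simp: G.m_assoc)
    show "(\<lambda>x. x) \<in> hom G G"
      by (auto intro: homI)
  qed (use kc in auto)
  then show ?thesis
    using kc x by (metis G.inv_solve_right' G.m_closed)
qed

text \<open>The endomorphism sending \<open>x\<close> to the power of \<open>b\<close> with exponent
  \<open>f x\<close> has values in the kernel, so it equals the trivial one. Since \<open>b\<close>
  has infinite order, the exponents vanish.\<close>

lemma cellular_cover_hom_int_zero:
  fixes f :: "'a \<Rightarrow> int"
  assumes "cellular_cover G M c" and b: "b \<in> kernel G M c"
    and tf: "\<And>n::int. b [^]\<^bsub>G\<^esub> n = \<one>\<^bsub>G\<^esub> \<Longrightarrow> n = 0"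
    and f: "\<And>x y. x \<in> carrier G \<Longrightarrow> y \<in> carrier G \<Longrightarrow> f (x \<otimes>\<^bsub>G\<^esub> y) = f x + f y"
    and x: "x \<in> carrier G"
  shows "f x = 0"
proof -
  interpret group_hom G M c
    using assms by (simp add: cellular_cover_def group_hom_def group_hom_axioms_def)
  have bc: "b \<in> carrier G" "c b = \<one>\<^bsub>M\<^esub>"
    using b by (auto simp: kernel_def)
  have "b [^]\<^bsub>G\<^esub> f x = \<one>\<^bsub>G\<^esub>"
  proof (rule cellular_cover_endomorphism_eq[OF assms(1) _ _ _ x])
    show "(\<lambda>x. b [^]\<^bsub>G\<^esub> f x) \<in> hom G G"
      using bc f by (intro homI) (auto simp: G.int_pow_mult)
    show "(\<lambda>x. \<one>\<^bsub>G\<^esub>) \<in> hom G G"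
      by (auto intro: homI)
    show "c (b [^]\<^bsub>G\<^esub> f y) = c \<one>\<^bsub>G\<^esub>" for y
      using bc by (simp add: hom_int_pow)
  qed
  then show ?thesis
    by (rule tf)
qed

section \<open>Cardinality of the kernel\<close>

lemma lepoll_iff_ordLeq: "A \<lesssim> B \<longleftrightarrow> |A| \<le>o |B|"
  by (simp add: lepoll_def card_of_ordLeq)

text \<open>For finite \<open>S\<close> the group is countable, and for infinite \<open>S\<close> it
  is equipollent to \<open>S\<close>.\<close>

lemma free_Abelian_group_lepoll_infinite:
  assumes "infinite B" "S \<lesssim> B"
  shows "carrier (free_Abelian_group S) \<lesssim> B"
proof (cases "finite S")
  case True
  have "carrier (free_Abelian_group S)
      \<lesssim> {f::'b\<Rightarrow>int. f ` S \<subseteq> UNIV \<and> {x. f x \<noteq> 0} \<subseteq> S \<and> finite {x. f x \<noteq> 0}}"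
    unfolding lepoll_def
    by (rule exI[of _ Poly_Mapping.lookup])
      (auto simp: poly_mapping_eqI lookup_not_eq_zero_eq_in_keys inj_onI)
  \<comment> \<open>A finitely supported function is determined by the finite part of its graph over
    its support.\<close>
  also have "\<dots> \<lesssim> Fpow (S \<times> (UNIV :: int set))"
    by (rule lepoll_restricted_funspace)
  also have "\<dots> \<lesssim> (UNIV :: nat set)"
  proof -
    have "countable (S \<times> (UNIV :: int set))"
      using True by (simp add: countable_finite)
    then have "countable (Fpow (S \<times> (UNIV :: int set)))"
      using countable_Collect_finite_subset by (simp add: Fpow_def conj_commute)
    then show ?thesis
      by (simp add: lepoll_def countable_def)
  qed
  also have "\<dots> \<lesssim> B"
    using assms(1) by (simp add: infinite_le_lepoll)
  finally show ?thesis .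
next
  case False
  then show ?thesis
    using assms(2) eqpoll_free_Abelian_group_infinite lepoll_trans1 by blast
qed

theorem theorem2:
  fixes G :: "('a, 'm) monoid_scheme" and M :: "('b, 'n) monoid_scheme" and c :: "'a \<Rightarrow> 'b"
  assumes "group M"
    and "cellular_cover G M c"
    and "is_free_abelian (G\<lparr>carrier := kernel G M c\<rparr>)"
  shows "kernel G M c \<lesssim> carrier M"
proof -
  interpret group_hom G M c
    using assms by (simp add: cellular_cover_def group_hom_def group_hom_axioms_def)
  let ?K = "kernel G M c" and ?N = "c ` carrier G"
  note central = cellular_cover_kernel_central[OF assms(2)]
  obtain S :: "'a set" and e where "e \<in> iso (G\<lparr>carrier := ?K\<rparr>) (free_Abelian_group S)"
    using assms(3) by (auto simp: is_free_abelian_def is_iso_def)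
  then have e: "bij_betw e ?K (carrier (free_Abelian_group S))"
    and add: "\<And>k l. k \<in> ?K \<Longrightarrow> l \<in> ?K \<Longrightarrow> e (k \<otimes>\<^bsub>G\<^esub> l) = e k + e l"
    by (auto simp: iso_def hom_def)
  have K: "subgroup ?K G"
    by (rule subgroup_kernel)
  have NM: "?N \<lesssim> carrier M"
    by (rule subset_imp_lepoll) auto
  obtain r where r: "\<And>k x. k \<in> ?K \<Longrightarrow> x \<in> carrier G \<Longrightarrow> r (k \<otimes>\<^bsub>G\<^esub> x) = e k + r x"
    using kernel_equivariant_map[of e] add by blast
  have ri: "Poly_Mapping.lookup (r (k \<otimes>\<^bsub>G\<^esub> x)) i
      = Poly_Mapping.lookup (e k) i + Poly_Mapping.lookup (r x) i"
    if "k \<in> ?K" "x \<in> carrier G" for k x i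
    using r[OF that] by (simp add: lookup_add)
  \<comment> \<open>This contradiction serves both cases below: \<open>m\<close> is the order of the
    image for the transfer, and 1 for a single coordinate of \<open>r\<close>.\<close>
  have no_hom: False
    if "i \<in> S" and f: "\<And>x y. x \<in> carrier G \<Longrightarrow> y \<in> carrier G \<Longrightarrow> f (x \<otimes>\<^bsub>G\<^esub> y) = f x + f y"
      and fK: "\<And>k. k \<in> ?K \<Longrightarrow> f k = m * Poly_Mapping.lookup (e k) i" and "m \<noteq> 0"
    for i m and f :: "'a \<Rightarrow> int"
  proof -
    have "frag_of i \<in> e ` ?K"
      using e \<open>i \<in> S\<close> by (simp add: bij_betw_def)
    then obtain b where b: "b \<in> ?K" "e b = frag_of i"
      by auto
    have bc: "b \<in> carrier G"
      using b by (simp add: kernel_def)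
    have fb: "f b = m"
      using fK[OF b(1)] b(2) by simp
    have f1: "f \<one>\<^bsub>G\<^esub> = 0"
      using f[of "\<one>\<^bsub>G\<^esub>" "\<one>\<^bsub>G\<^esub>"] by simp
    have finv: "f (inv\<^bsub>G\<^esub> x) = - f x" if "x \<in> carrier G" for x
      using f[of x "inv\<^bsub>G\<^esub> x"] f1 that by simp
    \<comment> \<open>\<open>b\<close> is the basis element with index \<open>i\<close>. The values
      \<open>n * m\<close> of \<open>f\<close> on its powers show that \<open>b\<close> has infinite
      order, so \<open>f\<close> must vanish although \<open>f b = m\<close>.\<close>
    have fpow: "f (b [^]\<^bsub>G\<^esub> n) = int n * m" for n :: nat
      using bc f fb f1 by (induction n) (auto simp: algebra_simps)
    have "f (b [^]\<^bsub>G\<^esub> n) = n * m" for n :: int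
      by (cases n rule: int_cases2) (use bc fpow finv in \<open>auto simp: G.int_pow_neg_int int_pow_int\<close>)
    then have "n = 0" if "b [^]\<^bsub>G\<^esub> n = \<one>\<^bsub>G\<^esub>" for n :: int
      using that f1 \<open>m \<noteq> 0\<close> by (metis mult_eq_0_iff)
    then have "f b = 0"
      using cellular_cover_hom_int_zero[OF assms(2) b(1) _ f bc] by blast
    then show False
      using fb \<open>m \<noteq> 0\<close> by simp
  qed
  show ?thesis
  proof (cases "S = {}")
    case True
    have "e ` ?K = {0}"
      using e True by (auto simp: bij_betw_def)
    then have "?K \<lesssim> {0 :: 'a \<Rightarrow>\<^sub>0 int}"
      using e by (metis bij_betw_def lepoll_def order_refl)
    also have "{0 :: 'a \<Rightarrow>\<^sub>0 int} \<lesssim> {\<one>\<^bsub>M\<^esub>}"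
      by (simp add: singleton_lepoll)
    also have "{\<one>\<^bsub>M\<^esub>} \<lesssim> carrier M"
      by (rule subset_imp_lepoll) simp
    finally show ?thesis .
  next
    case False
    then obtain j where j: "j \<in> S"
      by auto
    have inf: "infinite ?N"
    proof
      assume fin: "finite ?N"
      obtain T where "\<And>x y. x \<in> carrier G \<Longrightarrow> y \<in> carrier G \<Longrightarrow> T (x \<otimes>\<^bsub>G\<^esub> y) = T x + T y"
        and "\<And>k. k \<in> ?K \<Longrightarrow> T k = int (card ?N) * Poly_Mapping.lookup (e k) j"
        using transfer[OF fin central, of "\<lambda>x. Poly_Mapping.lookup (r x) j"
            "\<lambda>k. Poly_Mapping.lookup (e k) j"] ri by blast
      moreover have "int (card ?N) \<noteq> 0"
        using fin by (auto simp: card_eq_0_iff)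
      ultimately show False
        using no_hom[OF j] by blast
    qed
    define t where "t = inv_into (carrier G) c"
    have t: "t (c x) \<in> carrier G" "c (t (c x)) = c x" if "x \<in> carrier G" for x
      using that by (auto simp: t_def inv_into_into f_inv_into_f)
    \<comment> \<open>\<open>d\<close> is the defect of additivity of \<open>r\<close>, and
      \<open>J\<close> collects the coordinates in which it is ever nonzero, tested on
      representatives only.\<close>
    define d where "d x y = r (x \<otimes>\<^bsub>G\<^esub> y) - r x - r y" for x y
    define J where "J = (\<Union>(u, v) \<in> ?N \<times> ?N. Poly_Mapping.keys (d (t u) (t v)))"
    have d: "d x y = d (t (c x)) (t (c y))" if x: "x \<in> carrier G" and y: "y \<in> carrier G" for x y
    proof -
      \<comment> \<open>Centrality lets \<open>l\<close> move past \<open>u\<close>; then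
        \<open>e k + e l\<close> is added to the first term of \<open>d\<close> and subtracted again
        by the other two. Hence \<open>d\<close> depends only on the images under
        \<open>c\<close>.\<close>
      have dk: "d (k \<otimes>\<^bsub>G\<^esub> u) (l \<otimes>\<^bsub>G\<^esub> v) = d u v"
        if "k \<in> ?K" "l \<in> ?K" "u \<in> carrier G" "v \<in> carrier G" for k l u v
      proof -
        have kl: "k \<in> carrier G" "l \<in> carrier G" "k \<otimes>\<^bsub>G\<^esub> l \<in> ?K"
          using that K by (auto simp: kernel_def)
        have "k \<otimes>\<^bsub>G\<^esub> u \<otimes>\<^bsub>G\<^esub> (l \<otimes>\<^bsub>G\<^esub> v) = k \<otimes>\<^bsub>G\<^esub> ((u \<otimes>\<^bsub>G\<^esub> l) \<otimes>\<^bsub>G\<^esub> v)"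
          using that kl by (simp add: G.m_assoc)
        also have "\<dots> = (k \<otimes>\<^bsub>G\<^esub> l) \<otimes>\<^bsub>G\<^esub> (u \<otimes>\<^bsub>G\<^esub> v)"
          using that kl central[of l u] by (simp add: G.m_assoc flip: central)
        finally show ?thesis
          using that kl by (simp add: d_def r add)
      qed
      have "x \<otimes>\<^bsub>G\<^esub> inv\<^bsub>G\<^esub> t (c x) \<in> ?K" "y \<otimes>\<^bsub>G\<^esub> inv\<^bsub>G\<^esub> t (c y) \<in> ?K"
        using x y t by (auto intro!: kernel_mult_inv)
      from dk[OF this, of "t (c x)" "t (c y)"] show ?thesis
        using x y t by (simp add: G.m_assoc)
    qed
    have "S \<subseteq> J"
    proof
      fix i assume i: "i \<in> S"
      show "i \<in> J"
      proof (rule ccontr)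
        assume "i \<notin> J"
        then have d0: "Poly_Mapping.lookup (d x y) i = 0" if "x \<in> carrier G" "y \<in> carrier G" for x y
          using that d[OF that] by (auto simp: J_def in_keys_iff)
        let ?f = "\<lambda>x. Poly_Mapping.lookup (r x) i"
        have f: "?f (x \<otimes>\<^bsub>G\<^esub> y) = ?f x + ?f y" if "x \<in> carrier G" "y \<in> carrier G" for x y
          using d0[OF that] by (simp add: d_def lookup_minus)
        \<comment> \<open>Additivity gives \<open>?f\<close> the value 0 at the identity, so
          equivariance at the identity identifies \<open>?f\<close> on \<open>?K\<close> with the
          coordinate of \<open>e\<close>.\<close>
        have "?f k = 1 * Poly_Mapping.lookup (e k) i" if "k \<in> ?K" for k
          using ri[OF that G.one_closed, of i] f[of "\<one>\<^bsub>G\<^esub>" "\<one>\<^bsub>G\<^esub>"] that by (simp add: kernel_def)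
        with no_hom[OF i f] show False
          by (metis one_neq_zero)
      qed
    qed
    moreover have "J \<lesssim> ?N"
      unfolding J_def lepoll_iff_ordLeq
    \<comment> \<open>Each support is finite, and the index set of pairs is no larger than the
      infinite set \<open>?N\<close>.\<close>
    proof (rule card_of_UNION_ordLeq_infinite[OF inf])
      show "|?N \<times> ?N| \<le>o |?N|"
        using inf by (simp add: card_of_Times_ordLeq_infinite)
      show "\<forall>p \<in> ?N \<times> ?N. |case p of (u, v) \<Rightarrow> Poly_Mapping.keys (d (t u) (t v))| \<le>o |?N|"
        using inf by (auto simp flip: lepoll_iff_ordLeq intro!: lesspoll_imp_lepoll finite_lesspoll_infinite)
    qed
    ultimately have "S \<lesssim> ?N"
      using lepoll_trans subset_imp_lepoll by blast
    then have "carrier (free_Abelian_group S) \<lesssim> ?N"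
      by (rule free_Abelian_group_lepoll_infinite[OF inf])
    then have "?K \<lesssim> ?N"
      using e lepoll_trans1 eqpoll_def by blast
    then show ?thesis
      using NM lepoll_trans by blast
  qed
qed

end
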